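(* Let $\triangledown$ be the operator on $n\times n$ difference-bound matrices over $\overline{\mathbb I}$ (with $\mathbb I\in\{\mathbb Z,\mathbb Q,\mathbb R\}$) defined by $(\vec m\triangledown\vec n)_{ij}=\vec m_{ij}$ if $\vec n_{ij}\leq\vec m_{ij}$, and $+\infty$ otherwise. Then: 1. For all DBMs $\vec m,\vec n$: $\mathcal D^0(\vec m\triangledown\vec n)\supseteq\mathcal D^0(\vec m)\cup\mathcal D^0(\vec n)$. 2. (Finite chain property) For every DBM $\vec m$ and every sequence $(\vec n_i)_{i\in\mathbb N}$ of DBMs, the chain defined by $\vec x_0=\vec m$, $\vec x_{i+1}=\vec x_i\triangledown\vec n_i$ is increasing for $\trianglelefteq$ and ultimately stationary. Its limit $\vec l$ satisfies $\vec m\trianglelefteq\vec l$ and $\vec n_i\trianglelefteq\vec l$ for all $i$.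
   Context: Let $\mathbb I$ be $\mathbb Z$, $\mathbb Q$ or $\mathbb R$, and $\overline{\mathbb I}=\mathbb I\cup\{+\infty\}$ with the usual extended order and addition. A difference-bound matrix (DBM) is an $n\times n$ matrix $\vec m$ with entries in $\overline{\mathbb I}$. Define $\mathcal D(\vec m)=\{(x_1,\dots,x_n)\in\mathbb I^n\;|\;\forall i,j,\ x_j-x_i\leq\vec m_{ij}\}$ and the $\mathcal V^0$-domain $\mathcal D^0(\vec m)=\{(x_2,\dots,x_n)\in\mathbb I^{n-1}\;|\;(0,x_2,\dots,x_n)\in\mathcal D(\vec m)\}$. Order: $\vec m\trianglelefteq\vec n$ iff $\vec m_{ij}\leq\vec n_{ij}$ for all $i,j$. "Increasing" is meant in the non-strict sense. *)

theory Defs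
  imports Complex_Main "HOL-Library.Extended_Real" "Jordan_Normal_Form.Matrix"
begin

text \<open>
  Scalars are a set \<open>I\<close> of reals, meant to be \<open>\<int>\<close>, \<open>\<rat>\<close> or \<open>\<real>\<close>; adding \<open>+\<infinity>\<close> but not
  \<open>-\<infinity>\<close> gives a subset of \<open>ereal\<close>, whose order is the inherited one. Matrix and vector indices
  start at 0, so the distinguished first variable has index 0. The order \<open>\<le>\<close> on matrices is the
  entrywise one, and it requires equal dimensions.
\<close>

definition ext_scalars :: "real set \<Rightarrow> ereal set" where
  "ext_scalars I = insert \<infinity> (ereal ` I)"

definition dbms :: "real set \<Rightarrow> nat \<Rightarrow> ereal mat set" where
  "dbms I n = {m \<in> carrier_mat n n. \<forall>i<n. \<forall>j<n. m $$ (i, j) \<in> ext_scalars I}"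

definition points :: "real set \<Rightarrow> nat \<Rightarrow> real vec set" where
  "points I n = {x \<in> carrier_vec n. \<forall>i<n. x $ i \<in> I}"

definition dbm_domain :: "real set \<Rightarrow> nat \<Rightarrow> ereal mat \<Rightarrow> real vec set" where
  "dbm_domain I n m = {x \<in> points I n. \<forall>i<n. \<forall>j<n. ereal (x $ j - x $ i) \<le> m $$ (i, j)}"

definition dbm_domain0 :: "real set \<Rightarrow> nat \<Rightarrow> ereal mat \<Rightarrow> real vec set" where
  "dbm_domain0 I n m = {x \<in> points I (n - 1). vCons 0 x \<in> dbm_domain I n m}"

definition dbm_widen :: "ereal mat \<Rightarrow> ereal mat \<Rightarrow> ereal mat" (infixl \<open>\<triangledown>\<close> 65) where
  "m \<triangledown> m' = mat (dim_row m) (dim_col m)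
     (\<lambda>(i, j). if m' $$ (i, j) \<le> m $$ (i, j) then m $$ (i, j) else \<infinity>)"

lemma dbm_widen_closed:
  assumes "m \<in> dbms I n"
  shows "m \<triangledown> m' \<in> dbms I n"
  using assms unfolding dbms_def dbm_widen_def ext_scalars_def by fastforce

end

theory Submission
  imports Defs
begin

text \<open>Each entry of \<open>m \<triangledown> m'\<close> is either kept from \<open>m\<close>,
  which happens only when it already bounds the entry of \<open>m'\<close>, or is
  \<open>\<infinity>\<close>; so the widening is an entrywise upper bound of both arguments
  (\<open>le_dbm_widen_left\<close>, \<open>le_dbm_widen_right\<close>). Larger bounds mean weaker
  constraints, hence larger domains (\<open>dbm_domain0_mono\<close>), which gives the inclusion.
  Along a chain an entry can change at most once, to \<open>\<infinity>\<close>, and there are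
  finitely many entries, so the chain stabilises (\<open>dbm_widen_chain_eventually_const\<close>);
  its limit is above every term and so above every \<open>N i\<close>.\<close>

lemma dbm_widen_carrier [simp]:
  "m \<in> carrier_mat r c \<Longrightarrow> m \<triangledown> m' \<in> carrier_mat r c"
  by (auto simp: dbm_widen_def)

lemma index_dbm_widen:
  assumes "m \<in> carrier_mat r c" "i < r" "j < c"
  shows "(m \<triangledown> m') $$ (i, j) = (if m' $$ (i, j) \<le> m $$ (i, j) then m $$ (i, j) else \<infinity>)"
  using assms by (auto simp: dbm_widen_def)

lemma le_dbm_widen_left:
  assumes "m \<in> carrier_mat r c"
  shows "m \<le> m \<triangledown> m'"
  using assms by (auto simp: less_eq_mat_def dbm_widen_def)

lemma le_dbm_widen_right:
  assumes "m \<in> carrier_mat r c" "m' \<in> carrier_mat r c"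
  shows "m' \<le> m \<triangledown> m'"
  using assms by (auto simp: less_eq_mat_def dbm_widen_def)

lemma dbm_domain0_mono:
  assumes "m \<in> carrier_mat n n" "m \<le> m'"
  shows "dbm_domain0 I n m \<subseteq> dbm_domain0 I n m'"
proof -
  have "m $$ (i, j) \<le> m' $$ (i, j)" if "i < n" "j < n" for i j
    using assms that by (auto simp: less_eq_mat_def)
  then have "dbm_domain I n m \<subseteq> dbm_domain I n m'"
    unfolding dbm_domain_def by (blast intro: order_trans)
  then show ?thesis
    unfolding dbm_domain0_def by blast
qed

theorem dbm_domain0_widen:
  assumes "m \<in> carrier_mat n n" "m' \<in> carrier_mat n n"
  shows "dbm_domain0 I n m \<union> dbm_domain0 I n m' \<subseteq> dbm_domain0 I n (m \<triangledown> m')"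
  using assms by (simp add: dbm_domain0_mono le_dbm_widen_left le_dbm_widen_right)

text \<open>Each position is settled separately: its value is either constant forever or absorbed by
  \<open>\<infinity>\<close> at some index.\<close>

lemma dbm_widen_chain_eventually_const:
  assumes x0: "x 0 \<in> carrier_mat r c" and step: "\<And>k. x (Suc k) = x k \<triangledown> N k"
  obtains l where "\<forall>\<^sub>F k in sequentially. x k = l"
proof -
  have car: "x k \<in> carrier_mat r c" for k
    by (induction k) (simp_all add: x0 step)
  have entry: "\<exists>v. \<forall>\<^sub>F k in sequentially. x k $$ (i, j) = v" if ij: "i < r" "j < c" for i j
  proof (cases "\<exists>k. x k $$ (i, j) = \<infinity>")
    case True
    then obtain k where k: "x k $$ (i, j) = \<infinity>" by blast
    \<comment> \<open>Both branches of the widening return \<open>\<infinity>\<close> here.\<close>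
    have "x k' $$ (i, j) = \<infinity>" if "k \<le> k'" for k'
      using that by (induction rule: dec_induct) (simp_all add: k step index_dbm_widen[OF car ij])
    then show ?thesis
      using eventually_sequentially by blast
  next
    case False
    \<comment> \<open>Since \<open>\<infinity>\<close> never occurs, each step must have taken the
      branch that keeps the entry.\<close>
    have "x k $$ (i, j) = x 0 $$ (i, j)" for k
    proof (induction k)
      case (Suc k)
      then show ?case
        using False[simplified, rule_format, of "Suc k"]
        by (simp add: step index_dbm_widen[OF car ij] split: if_splits)
    qed simp
    then have "\<forall>\<^sub>F k in sequentially. x k $$ (i, j) = x 0 $$ (i, j)"
      by simp
    then show ?thesis ..
  qed
  then obtain v where
    v: "\<And>i j. i < r \<Longrightarrow> j < c \<Longrightarrow> \<forall>\<^sub>F k in sequentially. x k $$ (i, j) = v i j"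
    by metis
  \<comment> \<open>Finiteness of the index set merges the separate stabilisation ranks into a
    common one.\<close>
  have "\<forall>\<^sub>F k in sequentially. \<forall>p \<in> {..<r} \<times> {..<c}. x k $$ p = case_prod v p"
    by (intro eventually_ball_finite) (auto simp: v)
  then have "\<forall>\<^sub>F k in sequentially. x k = mat r c (case_prod v)"
  proof eventually_elim
    case (elim k)
    then show ?case using car[of k] by (intro eq_matI) auto
  qed
  then show ?thesis by (rule that)
qed

theorem theorem7:
  fixes I :: "real set" and n :: nat
  assumes "I = \<int> \<or> I = \<rat> \<or> I = \<real>" and "n \<ge> 1"
  shows "(\<forall>m \<in> dbms I n. \<forall>m' \<in> dbms I n.
            dbm_domain0 I n (m \<triangledown> m') \<supseteq> dbm_domain0 I n m \<union> dbm_domain0 I n m') \<and>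
         (\<forall>m \<in> dbms I n. \<forall>N :: nat \<Rightarrow> ereal mat. (\<forall>i. N i \<in> dbms I n) \<longrightarrow>
            (\<forall>x :: nat \<Rightarrow> ereal mat. x 0 = m \<and> (\<forall>i. x (Suc i) = x i \<triangledown> N i) \<longrightarrow>
               mono x \<and>
               (\<exists>l. (\<forall>\<^sub>F i in sequentially. x i = l) \<and> m \<le> l \<and> (\<forall>i. N i \<le> l))))"
proof (intro conjI ballI allI impI)
  fix m m' assume "m \<in> dbms I n" "m' \<in> dbms I n"
  then show "dbm_domain0 I n (m \<triangledown> m') \<supseteq> dbm_domain0 I n m \<union> dbm_domain0 I n m'"
    by (intro dbm_domain0_widen) (simp_all add: dbms_def)
next
  fix m and N x :: "nat \<Rightarrow> ereal mat"
  assume m: "m \<in> dbms I n" and N: "\<forall>i. N i \<in> dbms I n"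
    and x: "x 0 = m \<and> (\<forall>i. x (Suc i) = x i \<triangledown> N i)"
  have carN: "N k \<in> carrier_mat n n" for k
    using N by (simp add: dbms_def)
  have car: "x k \<in> carrier_mat n n" for k
    using m by (induction k) (simp_all add: x dbms_def)
  show mono: "mono x"
    unfolding mono_iff_le_Suc using le_dbm_widen_left[OF car] x by simp
  obtain l where l: "\<forall>\<^sub>F k in sequentially. x k = l"
    using dbm_widen_chain_eventually_const[of x n n N] car x by blast
  then obtain K where K: "\<And>k. K \<le> k \<Longrightarrow> x k = l"
    unfolding eventually_sequentially by blast
  have le_l: "x k \<le> l" for k
    using monoD[OF mono, of k "max k K"] K[of "max k K"] by simp
  \<comment> \<open>\<open>N k\<close> is absorbed one step later, in \<open>x (Suc k)\<close>,
    which lies below the limit.\<close>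
  have "N k \<le> l" for k
    using le_dbm_widen_right[OF car carN] x le_l[of "Suc k"] by (metis order_trans)
  then show "\<exists>l. (\<forall>\<^sub>F i in sequentially. x i = l) \<and> m \<le> l \<and> (\<forall>i. N i \<le> l)"
    using l le_l[of 0] x by blast
qed

end
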